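(* For every $t \in \mathbb{N}$ (with $0\in\mathbb N$) and all matrices $A_1,\dots,A_n \in \mathbb{R}^{p\times p}$, the quantity $$\mathbb{E}\left[\left\|\sum_{i=1}^{n} A_i \nabla L_i\left(w_{t}^b\right)\right\|^2 \,\middle|\, \mathcal{F}_0\right]$$ is a decreasing function of the mini-batch size $b$ for $b \in \{1,\dots,n\}$.
   Context: Mini-batch SGD for linear regression. Data $(x_1,y_1),\dots,(x_n,y_n)$ with $x_i\in\mathbb{R}^p$, $y_i\in\mathbb{R}$, $n\ge 2$. For $w\in\mathbb{R}^p$ let $L_i(w)=\frac12 (w^\top x_i-y_i)^2$, so $\nabla L_i(w)=(x_i^\top w-y_i)x_i$, and $L(w)=\frac1n\sum_{i=1}^n L_i(w)$. Fix initial weights $w_0\in\mathbb{R}^p$ and learning rates $\alpha_t>0$, both independent of $b$. For mini-batch size $b\in[n]=\{1,\dots,n\}$, set $w_0^b=w_0$ and, for each $t\ge0$, sample $\mathcal{B}_t^b$ uniformly at random among subsets of $[n]$ of cardinality $b$, independently over iterations, and set $w_{t+1}^b=w_t^b-\alpha_t g_t^b$, where $g_t^b=\frac1b\sum_{i\in\mathcal{B}_t^b}\nabla L_i(w_t^b)$. $\mathcal{F}_0$ is the information consisting of $w_0$ only, so conditioning on $\mathcal{F}_0$ means that $w_0$ is fixed and the randomness comes from the mini-batches. $\|\cdot\|$ is the Euclidean norm. "Decreasing" is in the non-strict sense (non-increasing). *)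

theory Defs
  imports "HOL-Probability.Probability"
begin

definition grad :: "('v::real_inner \<Rightarrow> real) \<Rightarrow> 'v \<Rightarrow> 'v" where
  "grad f w = (THE g. GDERIV f w :> g)"

definition sq_loss :: "real ^ 'p \<Rightarrow> real \<Rightarrow> real ^ 'p \<Rightarrow> real" where
  "sq_loss x y w = (w \<bullet> x - y)\<^sup>2 / 2"

lemma grad_eqI:
  assumes "GDERIV f w :> g"
  shows "grad f w = g"
  unfolding grad_def
proof (rule the_equality)
  fix h assume "GDERIV f w :> h"
  then have "(\<lambda>v. v \<bullet> h) = (\<lambda>v. v \<bullet> g)"
    using assms has_derivative_unique unfolding gderiv_def by blast
  then have "\<forall>v. v \<bullet> h = v \<bullet> g" by metis
  then show "h = g" using vector_eq_ldot by blast
qed (fact assms)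

lemma grad_sq_loss: "grad (sq_loss x y) w = (x \<bullet> w - y) *\<^sub>R x"
proof (rule grad_eqI)
  show "GDERIV (sq_loss x y) w :> (x \<bullet> w - y) *\<^sub>R x"
    unfolding gderiv_def sq_loss_def [abs_def]
    by (auto intro!: derivative_eq_intros simp: fun_eq_iff inner_commute inner_diff_right field_simps)
qed

definition minibatches :: "nat \<Rightarrow> nat \<Rightarrow> nat set set" where
  "minibatches n b = {S. S \<subseteq> {1..n} \<and> card S = b}"

text \<open>
  The batches \<open>B 0, B 1, \<dots>\<close> are independent random variables on the probability space \<open>M\<close>,
  each uniform on the subsets of \<open>{1..n}\<close> of cardinality \<open>b\<close>. Measurability of each
  \<open>B t\<close> is part of \<open>prob_space.indep_vars\<close>.
\<close>
definition minibatch_sampling ::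
    "'a measure \<Rightarrow> nat \<Rightarrow> nat \<Rightarrow> (nat \<Rightarrow> 'a \<Rightarrow> nat set) \<Rightarrow> bool" where
  "minibatch_sampling M n b B \<longleftrightarrow>
     prob_space.indep_vars M (\<lambda>_. count_space (minibatches n b)) B UNIV \<and>
     (\<forall>t. distr M (count_space (minibatches n b)) (B t)
            = uniform_count_measure (minibatches n b))"

text \<open>
  The iterate \<open>w\<^sub>t\<close> along one realisation \<open>S 0, S 1, \<dots>\<close> of the sequence of mini-batches.
\<close>
primrec sgd ::
    "(nat \<Rightarrow> real ^ 'p) \<Rightarrow> (nat \<Rightarrow> real) \<Rightarrow> (nat \<Rightarrow> real) \<Rightarrow> real ^ 'p \<Rightarrow> nat \<Rightarrow>
     (nat \<Rightarrow> nat set) \<Rightarrow> nat \<Rightarrow> real ^ 'p" where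
  "sgd x y \<alpha> w0 b S 0 = w0"
| "sgd x y \<alpha> w0 b S (Suc t) =
     sgd x y \<alpha> w0 b S t
       - \<alpha> t *\<^sub>R ((1 / real b) *\<^sub>R
           (\<Sum>i\<in>S t. grad (sq_loss (x i) (y i)) (sgd x y \<alpha> w0 b S t)))"

end

(* For convex h, averaging h over the mini-batch means is non-increasing in the batch size: the mean of
   a batch S of size b + 1 is the average of the means of the batches S - {i}, so Jensen's inequality
   applies. As each gradient is affine in w, the one-step operator
   (K_b h)(w) = E h(w - \<alpha> g^b(w)) is monotone, preserves convexity, and is non-increasing in b on
   convex functions. Since E h(w_(t+1)) = E (K_b h)(w_t), induction on t gives that E h(w_t) is
   non-increasing in b for every convex h, in particular for the squared norm of an affine map. *)
theory Submission
  imports Defs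
begin

section \<open>Convexity and mini-batch averages\<close>

text \<open>Affineness is stated through combinations with coefficients summing to 1, the form in
  which \<open>convex_on\<close> uses it, so the linear part of \<open>T\<close> never has to be
  split off.\<close>

lemma convex_on_affine_compose:
  fixes h :: "'b::real_vector \<Rightarrow> real"
  assumes "convex_on UNIV h"
    and "\<And>u v a b. a + b = 1 \<Longrightarrow> T (a *\<^sub>R u + b *\<^sub>R v) = a *\<^sub>R T u + b *\<^sub>R T v"
  shows "convex_on UNIV (\<lambda>w. h (T w))"
  using assms by (simp add: convex_on_def)

lemma convex_on_setsum:
  fixes f :: "'i \<Rightarrow> 'b::real_vector \<Rightarrow> real"
  assumes "\<And>i. i \<in> I \<Longrightarrow> convex_on UNIV (f i)"
  shows "convex_on UNIV (\<lambda>w. \<Sum>i\<in>I. f i w)"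
  using assms
  by (induction I rule: infinite_finite_induct) (auto simp: convex_on_const intro: convex_on_add)

text \<open>The triangle inequality, followed by convexity of the real square, which is monotone on
  the nonnegative reals.\<close>

lemma convex_on_norm_square: "convex_on UNIV (\<lambda>v::'b::real_normed_vector. (norm v)\<^sup>2)"
proof (rule convex_onI)
  fix s :: real and u v :: 'b
  assume s: "0 < s" "s < 1"
  have "norm ((1 - s) *\<^sub>R u + s *\<^sub>R v) \<le> (1 - s) * norm u + s * norm v"
    using s by (intro norm_triangle_le) simp
  then have "(norm ((1 - s) *\<^sub>R u + s *\<^sub>R v))\<^sup>2 \<le> ((1 - s) * norm u + s * norm v)\<^sup>2"
    by (intro power_mono) auto
  also have "\<dots> \<le> (1 - s) * (norm u)\<^sup>2 + s * (norm v)\<^sup>2"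
    using convex_onD[OF convex_power2, of s "norm u" "norm v"] s by simp
  finally show "(norm ((1 - s) *\<^sub>R u + s *\<^sub>R v))\<^sup>2 \<le> (1 - s) * (norm u)\<^sup>2 + s * (norm v)\<^sup>2" .
qed simp

section \<open>Counting mini-batches and averaging over them\<close>

lemma finite_minibatches [simp]: "finite (minibatches n b)"
  unfolding minibatches_def by (rule finite_subset[of _ "Pow {1..n}"]) auto

lemma card_minibatches: "card (minibatches n b) = n choose b"
  using n_subsets[of "{1..n}" b] by (simp add: minibatches_def)

text \<open>Double counting: removing \<open>i\<close> matches the pairs with \<open>i\<close> in a
  set of size \<open>b + 1\<close> with the pairs with \<open>i\<close> outside a set of size
  \<open>b\<close>, and each set of size \<open>b\<close> leaves \<open>n - b\<close> choices of
  \<open>i\<close>.\<close>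

lemma sum_minibatches_remove:
  fixes F :: "nat set \<Rightarrow> real"
  shows "(\<Sum>S\<in>minibatches n (Suc b). \<Sum>i\<in>S. F (S - {i})) = real (n - b) * (\<Sum>S\<in>minibatches n b. F S)"
proof -
  have fin: "finite S" if "S \<in> minibatches n k" for S n k
    using that by (auto simp: minibatches_def intro: finite_subset)
  have "(\<Sum>S\<in>minibatches n (Suc b). \<Sum>i\<in>S. F (S - {i}))
      = (\<Sum>(S, i)\<in>(SIGMA S:minibatches n (Suc b). S). F (S - {i}))"
    by (rule sum.Sigma) (auto intro: fin)
  also have "\<dots> = (\<Sum>(S, i)\<in>(SIGMA S:minibatches n b. {1..n} - S). F S)"
  proof (rule sum.reindex_bij_witness[where i = "\<lambda>(S, i). (insert i S, i)" and j = "\<lambda>(S, i). (S - {i}, i)"])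
    fix p assume p: "p \<in> (SIGMA S:minibatches n (Suc b). S)"
    obtain S i where "p = (S, i)" "S \<in> minibatches n (Suc b)" "i \<in> S"
      using p by auto
    then show "(case p of (S, i) \<Rightarrow> (S - {i}, i)) \<in> (SIGMA S:minibatches n b. {1..n} - S)"
      by (auto simp: minibatches_def)
  next
    fix p assume p: "p \<in> (SIGMA S:minibatches n b. {1..n} - S)"
    obtain S i where "p = (S, i)" "S \<in> minibatches n b" "i \<in> {1..n} - S"
      using p by auto
    then show "(case p of (S, i) \<Rightarrow> (insert i S, i)) \<in> (SIGMA S:minibatches n (Suc b). S)"
      using fin[of S n b] by (auto simp: minibatches_def)
  qed (auto simp: insert_absorb)
  also have "\<dots> = (\<Sum>S\<in>minibatches n b. \<Sum>i\<in>{1..n} - S. F S)"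
    using sum.Sigma[of "minibatches n b" "\<lambda>S. {1..n} - S" "\<lambda>S i. F S"] by simp
  also have "\<dots> = (\<Sum>S\<in>minibatches n b. real (n - b) * F S)"
  proof (rule sum.cong)
    fix S assume "S \<in> minibatches n b"
    then have "card ({1..n} - S) = n - b"
      using card_Diff_subset[of S "{1..n}"] fin[of S n b] by (simp add: minibatches_def)
    then show "(\<Sum>i\<in>{1..n} - S. F S) = real (n - b) * F S"
      by simp
  qed simp
  finally show ?thesis
    by (simp add: sum_distrib_left)
qed

text \<open>The expectation over a uniformly drawn batch, kept as a finite sum so that the convexity
  argument is free of measure theory.\<close>

definition minibatch_average :: "nat \<Rightarrow> nat \<Rightarrow> (nat set \<Rightarrow> real) \<Rightarrow> real" where
  "minibatch_average n b F = (\<Sum>S\<in>minibatches n b. F S) / real (card (minibatches n b))"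

text \<open>Deleting a uniformly chosen element from a uniform batch of size \<open>b + 1\<close>
  yields a uniform batch of size \<open>b\<close>.\<close>

lemma minibatch_average_remove:
  assumes "b < n"
  shows "minibatch_average n (Suc b) (\<lambda>S. (\<Sum>i\<in>S. F (S - {i})) / real (Suc b)) = minibatch_average n b F"
proof -
  \<comment> \<open>Both products equal \<open>n * ((n - 1) choose b)\<close>.\<close>
  have "(n choose Suc b) * Suc b = (n choose b) * (n - b)"
    using binomial_absorption[of b n] binomial_absorb_comp[of n b] by (simp add: mult.commute)
  then have "real (n choose Suc b) * real (Suc b) = real (n choose b) * real (n - b)"
    by (metis of_nat_mult)
  moreover have "real (n choose b) > 0" "real (n - b) > 0"
    using assms by auto
  ultimately show ?thesis
    unfolding minibatch_average_def sum_divide_distrib[symmetric] sum_minibatches_remove card_minibatches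
      divide_divide_eq_left
    by (metis (no_types, lifting) less_irrefl mult.commute nonzero_mult_divide_mult_cancel_left)
qed

lemma minibatch_average_mono:
  assumes "\<And>S. S \<in> minibatches n b \<Longrightarrow> F S \<le> G S"
  shows "minibatch_average n b F \<le> minibatch_average n b G"
  unfolding minibatch_average_def using assms by (intro divide_right_mono sum_mono) auto

lemma minibatch_average_mean_Suc_le:
  fixes v :: "nat \<Rightarrow> 'v::real_vector" and h :: "'v \<Rightarrow> real"
  assumes h: "convex_on UNIV h" and b: "0 < b" "b < n"
  shows "minibatch_average n (Suc b) (\<lambda>S. h ((1 / real (Suc b)) *\<^sub>R (\<Sum>i\<in>S. v i)))
       \<le> minibatch_average n b (\<lambda>S. h ((1 / real b) *\<^sub>R (\<Sum>i\<in>S. v i)))"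
proof -
  define m where "m S = (1 / real b) *\<^sub>R (\<Sum>i\<in>S. v i)" for S :: "nat set"
  have "h ((1 / real (Suc b)) *\<^sub>R (\<Sum>i\<in>S. v i)) \<le> (\<Sum>i\<in>S. h (m (S - {i}))) / real (Suc b)"
    if "S \<in> minibatches n (Suc b)" for S
  proof -
    have S: "finite S" "card S = Suc b" "S \<noteq> {}"
      using that by (auto simp: minibatches_def intro: finite_subset)
    have "(\<Sum>i\<in>S. m (S - {i})) = (1 / real b) *\<^sub>R (\<Sum>i\<in>S. (\<Sum>j\<in>S. v j) - v i)"
      unfolding m_def scaleR_sum_right[symmetric]
      using S by (simp add: sum_diff1)
    \<comment> \<open>Each \<open>v j\<close> is missing from exactly one of the
      \<open>b + 1\<close> leave-one-out sums, so it is counted \<open>b\<close> times.\<close>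
    also have "(\<Sum>i\<in>S. (\<Sum>j\<in>S. v j) - v i) = real b *\<^sub>R (\<Sum>j\<in>S. v j)"
      using S by (simp add: sum_subtractf sum_constant_scaleR scaleR_add_left)
    finally have "(\<Sum>i\<in>S. m (S - {i})) = (\<Sum>j\<in>S. v j)"
      using b by simp
    then have "h ((1 / real (Suc b)) *\<^sub>R (\<Sum>i\<in>S. v i)) = h (\<Sum>i\<in>S. (1 / real (Suc b)) *\<^sub>R m (S - {i}))"
      by (simp only: scaleR_sum_right[symmetric])
    \<comment> \<open>Jensen's inequality with equal weights, which sum to 1 because
      \<open>S\<close> has \<open>Suc b\<close> elements.\<close>
    also have "\<dots> \<le> (\<Sum>i\<in>S. (1 / real (Suc b)) * h (m (S - {i})))"
      using S by (intro convex_on_sum[OF _ _ h]) auto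
    finally show ?thesis
      by (simp add: sum_divide_distrib)
  qed
  then have "minibatch_average n (Suc b) (\<lambda>S. h ((1 / real (Suc b)) *\<^sub>R (\<Sum>i\<in>S. v i)))
      \<le> minibatch_average n (Suc b) (\<lambda>S. (\<Sum>i\<in>S. h (m (S - {i}))) / real (Suc b))"
    by (rule minibatch_average_mono)
  also have "\<dots> = minibatch_average n b (\<lambda>S. h (m S))"
    using b by (intro minibatch_average_remove)
  finally show ?thesis
    by (simp add: m_def)
qed

lemma minibatch_average_mean_antimono:
  fixes v :: "nat \<Rightarrow> 'v::real_vector" and h :: "'v \<Rightarrow> real"
  assumes h: "convex_on UNIV h" and b: "0 < b" and "b \<le> b'" and "b' \<le> n"
  shows "minibatch_average n b' (\<lambda>S. h ((1 / real b') *\<^sub>R (\<Sum>i\<in>S. v i)))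
       \<le> minibatch_average n b (\<lambda>S. h ((1 / real b) *\<^sub>R (\<Sum>i\<in>S. v i)))"
  using \<open>b \<le> b'\<close> \<open>b' \<le> n\<close>
proof (induction b' rule: dec_induct)
  case (step k)
  then show ?case
    using minibatch_average_mean_Suc_le[OF h, of k n v] b by simp
qed simp


section \<open>Independent mini-batches\<close>

text \<open>A finite product of finite discrete spaces is again discrete: singletons are finite
  boxes, hence measurable, and every subset is a finite union of them.\<close>

lemma measurable_PiM_count_space_finite:
  assumes "finite I" "finite K" "f \<in> (I \<rightarrow>\<^sub>E K) \<rightarrow> space N"
  shows "f \<in> measurable (PiM I (\<lambda>_. count_space K)) N"
proof -
  have singleton: "{g} \<in> sets (PiM I (\<lambda>_. count_space K))" if "g \<in> I \<rightarrow>\<^sub>E K" for g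
  proof -
    have "(\<Pi>\<^sub>E i\<in>I. {g i}) \<in> sets (PiM I (\<lambda>_. count_space K))"
      by (rule sets_PiM_I_finite[OF assms(1)]) (use that in \<open>auto dest: PiE_mem\<close>)
    also have "(\<Pi>\<^sub>E i\<in>I. {g i}) = {g}"
      by (rule PiE_singleton) (use that in \<open>simp add: PiE_def\<close>)
    finally show ?thesis .
  qed
  have fin: "finite (I \<rightarrow>\<^sub>E K)"
    using assms(1,2) by (intro finite_PiE) auto
  have sets: "X \<in> sets (PiM I (\<lambda>_. count_space K))" if X: "X \<subseteq> I \<rightarrow>\<^sub>E K" for X
    by (rule sets.countable[OF singleton countable_finite[OF finite_subset[OF X fin]]]) (use X in blast)
  show ?thesis
  proof (rule measurableI)
    fix g assume "g \<in> space (PiM I (\<lambda>_. count_space K))"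
    then show "f g \<in> space N"
      using assms(3) by (auto simp: space_PiM)
  next
    fix A
    show "f -` A \<inter> space (PiM I (\<lambda>_. count_space K)) \<in> sets (PiM I (\<lambda>_. count_space K))"
      by (rule sets) (simp add: space_PiM)
  qed
qed

context prob_space
begin

text \<open>Since \<open>X\<close> takes values in a finite set, the composition with
  \<open>g\<close> is bounded; the sum of all values of \<open>norm (g f)\<close> serves as the
  bound.\<close>

lemma integrable_PiM_count_space_finite:
  fixes g :: "('i \<Rightarrow> 'k) \<Rightarrow> real"
  assumes "finite I" "finite K" "random_variable (PiM I (\<lambda>_. count_space K)) X"
  shows "integrable M (\<lambda>\<omega>. g (X \<omega>))"
proof (rule integrable_const_bound)
  have fin: "finite (I \<rightarrow>\<^sub>E K)"
    using assms(1,2) by (intro finite_PiE) auto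
  have "norm (g (X \<omega>)) \<le> (\<Sum>f\<in>I \<rightarrow>\<^sub>E K. norm (g f))" if "\<omega> \<in> space M" for \<omega>
  proof (rule member_le_sum[OF _ _ fin])
    show "X \<omega> \<in> I \<rightarrow>\<^sub>E K"
      using measurable_space[OF assms(3) that] by (simp add: space_PiM)
  qed simp
  then show "AE \<omega> in M. norm (g (X \<omega>)) \<le> (\<Sum>f\<in>I \<rightarrow>\<^sub>E K. norm (g f))"
    by (rule AE_I2)
  have "g \<in> borel_measurable (PiM I (\<lambda>_. count_space K))"
    by (rule measurable_PiM_count_space_finite[OF assms(1,2)]) simp
  then show "(\<lambda>\<omega>. g (X \<omega>)) \<in> borel_measurable M"
    by (rule measurable_compose[OF assms(3)])
qed

text \<open>The batch at time \<open>t\<close> is independent of the history \<open>X\<close>, so it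
  can be averaged out with the history held fixed. Splitting by the value of \<open>B t\<close>
  reduces this to products of independent real variables.\<close>

lemma expectation_indep_uniform:
  fixes B :: "nat \<Rightarrow> 'a \<Rightarrow> 'k" and F :: "(nat \<Rightarrow> 'k) \<Rightarrow> 'k \<Rightarrow> real"
  assumes ind: "indep_vars (\<lambda>_. count_space K) B UNIV" and K: "finite K"
    and Y: "distr M (count_space K) (B t) = uniform_count_measure K"
  defines "X \<equiv> \<lambda>\<omega>. restrict (\<lambda>s. B s \<omega>) {..<t}"
  shows "expectation (\<lambda>\<omega>. F (X \<omega>) (B t \<omega>)) = expectation (\<lambda>\<omega>. (\<Sum>k\<in>K. F (X \<omega>) k) / card K)"
proof -
  have Ym: "random_variable (count_space K) (B t)"
    using ind by (simp add: indep_vars_def)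
  have indX: "indep_var (PiM {..<t} (\<lambda>_. count_space K)) X
      (PiM {t} (\<lambda>_. count_space K)) (\<lambda>\<omega>. restrict (\<lambda>s. B s \<omega>) {t})"
    unfolding X_def by (rule indep_var_restrict[OF ind]) auto
  define J where "J k \<omega> = indicat_real {k} (B t \<omega>)" for k \<omega>
  have J: "indep_var borel (\<lambda>\<omega>. F (X \<omega>) k) borel (J k)" for k
  proof -
    have "indep_var borel ((\<lambda>f. F f k) \<circ> X) borel ((\<lambda>f. indicat_real {k} (f t)) \<circ> (\<lambda>\<omega>. restrict (\<lambda>s. B s \<omega>) {t}))"
      by (rule indep_var_compose[OF indX]; rule measurable_PiM_count_space_finite) (auto simp: K)
    then show ?thesis
      by (simp add: comp_def J_def [abs_def])
  qed
  have int: "integrable M (\<lambda>\<omega>. F (X \<omega>) k)" for k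
    using integrable_PiM_count_space_finite[OF _ K indep_var_rv1[OF indX], of "\<lambda>f. F f k"] by simp
  have Jint: "integrable M (J k)" for k
    using indep_var_rv2[OF J]
    by (intro integrable_const_bound[where B = 1]) (auto simp: J_def)
  have Jexp: "expectation (J k) = 1 / card K" if "k \<in> K" for k
  proof -
    have "expectation (J k) = integral\<^sup>L (distr M (count_space K) (B t)) (indicat_real {k})"
      unfolding J_def by (rule integral_distr[symmetric]) (use Ym in auto)
    also have "\<dots> = 1 / card K"
      unfolding Y using that K by (simp add: measure_uniform_count_measure)
    finally show ?thesis .
  qed
  \<comment> \<open>Exactly one of the indicators \<open>J k\<close> with \<open>k \<in> K\<close>
    equals 1, namely the one for \<open>k = B t \<omega>\<close>.\<close>
  have "expectation (\<lambda>\<omega>. F (X \<omega>) (B t \<omega>)) = expectation (\<lambda>\<omega>. \<Sum>k\<in>K. F (X \<omega>) k * J k \<omega>)"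
  proof (rule Bochner_Integration.integral_cong[OF refl])
    fix \<omega> assume "\<omega> \<in> space M"
    then have "B t \<omega> \<in> K"
      using measurable_space[OF Ym] by simp
    moreover have "(\<Sum>k\<in>K. F (X \<omega>) k * J k \<omega>) = (\<Sum>k\<in>K. if B t \<omega> = k then F (X \<omega>) k else 0)"
      by (intro sum.cong) (auto simp: J_def)
    ultimately show "F (X \<omega>) (B t \<omega>) = (\<Sum>k\<in>K. F (X \<omega>) k * J k \<omega>)"
      using K by simp
  qed
  also have "\<dots> = (\<Sum>k\<in>K. expectation (\<lambda>\<omega>. F (X \<omega>) k * J k \<omega>))"
    using indep_var_integrable[OF J int Jint] by (intro Bochner_Integration.integral_sum) auto
  also have "\<dots> = (\<Sum>k\<in>K. expectation (\<lambda>\<omega>. F (X \<omega>) k) * (1 / card K))"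
    using indep_var_lebesgue_integral[OF J int Jint] Jexp by (intro sum.cong) auto
  also have "\<dots> = expectation (\<lambda>\<omega>. (\<Sum>k\<in>K. F (X \<omega>) k) / card K)"
    using int by (simp add: sum_divide_distrib Bochner_Integration.integral_sum)
  finally show ?thesis .
qed

end

text \<open>Lets the infinite batch sequence be replaced by its restriction to
  \<open>{..<t}\<close>, which ranges over a finite set when the batches do.\<close>

lemma sgd_cong:
  assumes "\<And>s. s < t \<Longrightarrow> S s = S' s"
  shows "sgd x y \<alpha> w0 b S t = sgd x y \<alpha> w0 b S' t"
  using assms by (induction t) auto

section \<open>The one-step operator\<close>

text \<open>The Markov operator of one step with learning rate \<open>a\<close>: the expected value
  of \<open>h\<close> after the step, as a function of the current iterate.\<close>

definition sgd_operator ::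
    "(nat \<Rightarrow> real ^ 'p) \<Rightarrow> (nat \<Rightarrow> real) \<Rightarrow> real \<Rightarrow> nat \<Rightarrow> nat \<Rightarrow> (real ^ 'p \<Rightarrow> real) \<Rightarrow> real ^ 'p \<Rightarrow> real" where
  "sgd_operator x y a n b h w = minibatch_average n b
     (\<lambda>S. h (w - a *\<^sub>R ((1 / real b) *\<^sub>R (\<Sum>i\<in>S. grad (sq_loss (x i) (y i)) w))))"

lemma grad_sq_loss_affine:
  assumes "a + b = 1"
  shows "grad (sq_loss x y) (a *\<^sub>R u + b *\<^sub>R v) = a *\<^sub>R grad (sq_loss x y) u + b *\<^sub>R grad (sq_loss x y) v"
proof -
  \<comment> \<open>The offset \<open>y\<close> splits as \<open>a * y + b * y\<close>; this is
    where the coefficients must sum to 1, since the gradient is affine and in general not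
    linear.\<close>
  have "x \<bullet> (a *\<^sub>R u + b *\<^sub>R v) - y = a * (x \<bullet> u - y) + b * (x \<bullet> v - y)"
    using arg_cong[OF assms, of "\<lambda>c. c * y"] by (simp add: inner_add_right algebra_simps)
  then show ?thesis
    by (simp add: grad_sq_loss scaleR_add_left)
qed

text \<open>For a fixed batch the update is affine in the iterate, so each summand is convex in
  \<open>w\<close>, and averaging keeps convexity.\<close>

lemma convex_on_sgd_operator:
  assumes "convex_on UNIV h"
  shows "convex_on UNIV (sgd_operator x y a n b h)"
proof -
  define T where "T S w = w - a *\<^sub>R ((1 / real b) *\<^sub>R (\<Sum>i\<in>S. grad (sq_loss (x i) (y i)) w))" for S w
  have "T S (c *\<^sub>R u + d *\<^sub>R v) = c *\<^sub>R T S u + d *\<^sub>R T S v" if "c + d = 1" for S u v and c d :: real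
    by (simp add: T_def grad_sq_loss_affine[OF that] sum.distrib scaleR_add_right scaleR_diff_right
        mult.commute flip: scaleR_sum_right)
  then have "convex_on UNIV (\<lambda>w. h (T S w))" for S
    by (intro convex_on_affine_compose[OF assms])
  then have "convex_on UNIV (\<lambda>w. (\<Sum>S\<in>minibatches n b. h (T S w)) / real (card (minibatches n b)))"
    by (intro convex_on_cdiv convex_on_setsum) auto
  then show ?thesis
    by (simp add: sgd_operator_def [abs_def] minibatch_average_def T_def)
qed

text \<open>With \<open>w\<close> held fixed the gradients are fixed vectors, and the batch enters
  only through their mean.\<close>

lemma sgd_operator_antimono:
  fixes w :: "real ^ 'p"
  assumes "convex_on UNIV h" "0 < b" "b \<le> b'" "b' \<le> n"
  shows "sgd_operator x y a n b' h w \<le> sgd_operator x y a n b h w"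
  unfolding sgd_operator_def
proof (rule minibatch_average_mean_antimono[where h = "\<lambda>u. h (w - a *\<^sub>R u)", OF _ assms(2-)])
  show "convex_on UNIV (\<lambda>u. h (w - a *\<^sub>R u))"
  proof (rule convex_on_affine_compose[OF assms(1)])
    fix u v :: "real ^ 'p" and c d :: real
    assume "c + d = 1"
    then have "w = c *\<^sub>R w + d *\<^sub>R w"
      by (metis scaleR_add_left scaleR_one)
    then show "w - a *\<^sub>R (c *\<^sub>R u + d *\<^sub>R v) = c *\<^sub>R (w - a *\<^sub>R u) + d *\<^sub>R (w - a *\<^sub>R v)"
      by (simp add: scaleR_add_right scaleR_diff_right mult.commute)
  qed
qed

section \<open>Expectations along the iterates\<close>

text \<open>The iterate is determined by finitely many batches, each with finitely many values, so
  every real function of it is integrable.\<close>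

lemma integrable_sgd:
  fixes h :: "real ^ 'p \<Rightarrow> real"
  assumes "prob_space M" "minibatch_sampling M n b B"
  shows "integrable M (\<lambda>\<omega>. h (sgd x y \<alpha> w0 b (\<lambda>s. B s \<omega>) t))"
proof -
  interpret prob_space M by fact
  have B: "random_variable (PiM {..<t} (\<lambda>_. count_space (minibatches n b))) (\<lambda>\<omega>. restrict (\<lambda>s. B s \<omega>) {..<t})"
    using assms(2) by (intro measurable_restrict) (simp add: minibatch_sampling_def indep_vars_def)
  have "sgd x y \<alpha> w0 b (\<lambda>s. B s \<omega>) t = sgd x y \<alpha> w0 b (restrict (\<lambda>s. B s \<omega>) {..<t}) t" for \<omega>
    by (rule sgd_cong) simp
  then show ?thesis
    using integrable_PiM_count_space_finite[OF _ _ B, of "\<lambda>S. h (sgd x y \<alpha> w0 b S t)"] by simp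
qed

text \<open>The tower property, conditioning on the first \<open>t\<close> batches.\<close>

lemma expectation_sgd_Suc:
  fixes h :: "real ^ 'p \<Rightarrow> real"
  assumes "prob_space M" "minibatch_sampling M n b B"
  shows "prob_space.expectation M (\<lambda>\<omega>. h (sgd x y \<alpha> w0 b (\<lambda>s. B s \<omega>) (Suc t)))
       = prob_space.expectation M (\<lambda>\<omega>. sgd_operator x y (\<alpha> t) n b h (sgd x y \<alpha> w0 b (\<lambda>s. B s \<omega>) t))"
proof -
  interpret prob_space M by fact
  let ?X = "\<lambda>\<omega>. restrict (\<lambda>s. B s \<omega>) {..<t}"
  \<comment> \<open>\<open>F\<close> separates the earlier batches \<open>f\<close>, which determine
    the current iterate, from the fresh batch \<open>S\<close>.\<close>
  define F where "F f S = (let w = sgd x y \<alpha> w0 b f t in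
    h (w - \<alpha> t *\<^sub>R ((1 / real b) *\<^sub>R (\<Sum>i\<in>S. grad (sq_loss (x i) (y i)) w))))" for f S
  have X: "sgd x y \<alpha> w0 b (\<lambda>s. B s \<omega>) t = sgd x y \<alpha> w0 b (?X \<omega>) t" for \<omega>
    by (rule sgd_cong) simp
  have "expectation (\<lambda>\<omega>. F (?X \<omega>) (B t \<omega>))
      = expectation (\<lambda>\<omega>. (\<Sum>S\<in>minibatches n b. F (?X \<omega>) S) / card (minibatches n b))"
    using assms(2)
    by (intro expectation_indep_uniform[of "minibatches n b" B t F]) (simp_all add: minibatch_sampling_def)
  then show ?thesis
    by (simp add: X F_def Let_def sgd_operator_def minibatch_average_def)
qed

text \<open>The two runs are compared in expectation, through a hybrid that takes \<open>t\<close>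
  steps with batch size \<open>b'\<close> and the last one with size \<open>b\<close>.\<close>

lemma expectation_convex_sgd_antimono:
  fixes h :: "real ^ 'p \<Rightarrow> real"
  assumes M: "prob_space M"
    and B: "minibatch_sampling M n b B" and B': "minibatch_sampling M n b' B'"
    and b: "0 < b" "b \<le> b'" "b' \<le> n"
    and h: "convex_on UNIV h"
  shows "prob_space.expectation M (\<lambda>\<omega>. h (sgd x y \<alpha> w0 b' (\<lambda>s. B' s \<omega>) t))
       \<le> prob_space.expectation M (\<lambda>\<omega>. h (sgd x y \<alpha> w0 b (\<lambda>s. B s \<omega>) t))"
  using h
\<comment> \<open>\<open>h\<close> stays arbitrary because the induction hypothesis is applied to
  its image under the one-step operator, which is again convex. At time 0 both iterates are
  \<open>w0\<close>.\<close>
proof (induction t arbitrary: h)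
  case (Suc t)
  interpret prob_space M by fact
  let ?w = "\<lambda>\<omega>. sgd x y \<alpha> w0 b (\<lambda>s. B s \<omega>) t" and ?w' = "\<lambda>\<omega>. sgd x y \<alpha> w0 b' (\<lambda>s. B' s \<omega>) t"
  have "expectation (\<lambda>\<omega>. sgd_operator x y (\<alpha> t) n b' h (?w' \<omega>))
      \<le> expectation (\<lambda>\<omega>. sgd_operator x y (\<alpha> t) n b h (?w' \<omega>))"
    by (intro integral_mono integrable_sgd[OF M B'] sgd_operator_antimono Suc.prems b)
  also have "\<dots> \<le> expectation (\<lambda>\<omega>. sgd_operator x y (\<alpha> t) n b h (?w \<omega>))"
    by (rule Suc.IH[OF convex_on_sgd_operator[OF Suc.prems]])
  finally show ?case
    by (simp only: expectation_sgd_Suc[OF M B] expectation_sgd_Suc[OF M B'])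
qed simp

text \<open>Conditioning on the initial information is encoded by taking \<open>w0\<close> as a
  fixed vector, so the expectation is the plain one over \<open>M\<close>.\<close>

theorem theorem1:
  fixes n :: nat
    and x :: "nat \<Rightarrow> real ^ 'p" and y :: "nat \<Rightarrow> real"
    and w0 :: "real ^ 'p" and \<alpha> :: "nat \<Rightarrow> real"
    and M :: "'a measure" and B :: "nat \<Rightarrow> nat \<Rightarrow> 'a \<Rightarrow> nat set"
    and t :: nat and A :: "nat \<Rightarrow> real ^ 'p ^ 'p"
  assumes "n \<ge> 2"
    and "\<And>s. \<alpha> s > 0"
    and "prob_space M"
    and "\<And>b. b \<in> {1..n} \<Longrightarrow> minibatch_sampling M n b (B b)"
  shows "antimono_on {1..n}
           (\<lambda>b. prob_space.expectation M (\<lambda>\<omega>.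
              (norm (\<Sum>i=1..n. A i *v
                 grad (sq_loss (x i) (y i)) (sgd x y \<alpha> w0 b (\<lambda>s. B b s \<omega>) t)))\<^sup>2))"
proof (rule monotone_onI)
  fix b b' assume b: "b \<in> {1..n}" "b' \<in> {1..n}" "b \<le> b'"
  define h where "h w = (norm (\<Sum>i=1..n. A i *v grad (sq_loss (x i) (y i)) w))\<^sup>2" for w
  \<comment> \<open>Each gradient is affine in \<open>w\<close> and each \<open>A i\<close> acts
    linearly, so the vector inside the norm is affine in \<open>w\<close>.\<close>
  have "convex_on UNIV h"
    unfolding h_def [abs_def]
    by (rule convex_on_affine_compose[OF convex_on_norm_square])
       (simp add: grad_sq_loss_affine matrix_vector_right_distrib matrix_vector_mult_scaleR
          sum.distrib scaleR_sum_right)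
  then show "prob_space.expectation M (\<lambda>\<omega>. (norm (\<Sum>i=1..n. A i *v
        grad (sq_loss (x i) (y i)) (sgd x y \<alpha> w0 b (\<lambda>s. B b s \<omega>) t)))\<^sup>2)
      \<ge> prob_space.expectation M (\<lambda>\<omega>. (norm (\<Sum>i=1..n. A i *v
        grad (sq_loss (x i) (y i)) (sgd x y \<alpha> w0 b' (\<lambda>s. B b' s \<omega>) t)))\<^sup>2)"
    using expectation_convex_sgd_antimono[OF assms(3) assms(4)[OF b(1)] assms(4)[OF b(2)], of h] b
    by (simp add: h_def)
qed

end
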